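(* Let $(G,+)$ be an abelian group and let $n\le s<m$ be positive integers with $m<\lceil\log_2 p(G)\rceil/2$. Let $a\in G$ be nonzero, and let $S,S'\subseteq[m]_a$ with $|S|=|S'|=n$. Let $M=SM_m(a,S)$ or $M=\mathcal{P}_{n,s,m}(a)$. Then $M$ is matched to $SM_m(a,S')$ if and only if $SM_m(a,S')$ is isomorphic to the uniform matroid $U_{n,m}$.
   Context: $p(G)$ is the smallest cardinality of a nonzero finite subgroup of $G$, with $p(G)=\infty$ if none exists (so the condition on $m$ is vacuous for torsion-free $G$). Under this condition one fixes a total order $\preceq$ on $[2m]_a\cup\{0\}$ compatible with the group structure (for $x,y,z$ in the set, $x\preceq y$ implies $x+z\preceq y+z$ when these sums lie in the set). For positive integer $k$, $ka=a+\cdots+a$ ($k$ times) and $[k]_a=\{a,2a,\dots,ka\}$. Extended panhandle matroid: $\mathcal{P}_{n,s,m}(a)$ is the rank-$n$ matroid on ground set $[m]_a$ whose bases are the $n$-subsets $B\subseteq[m]_a$ with $|B\cap[s]_a|\ge n-1$. Extended Schubert matroid: for an $n$-subset $S\subseteq[m]_a$, $SM_m(a,S)$ is the rank-$n$ matroid on $[m]_a$ whose bases are the $n$-subsets $T\subseteq[m]_a$ such that the $i$-th smallest element of $T$ does not exceed the $i$-th smallest element of $S$ for each $1\le i\le n$ (with respect to $\preceq$ when $a$ is positive; for negative $a$ the analogous counterpart, i.e. comparing $ka$ by the index $k$). $U_{n,m}$ is the uniform matroid of rank $n$ on $m$ elements. Matchings: for matroids $M,N$ over $G$ (ground sets in $G$)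 of equal rank $n>0$, ordered bases $\{a_1,\dots,a_n\}$ of $M$ and $\{b_1,\dots,b_n\}$ of $N$ are matched if $a_i+b_i\notin E(M)$ for all $i$; $M$ is matched to $N$ if every basis of $M$ is matched to some basis of $N$. *)

theory Defs
  imports Complex_Main "HOL-Library.Extended_Nat"
begin

section \<open>Multiples of a group element and the bound $p(G)$\<close>

primrec nmult :: "nat \<Rightarrow> 'a::ab_group_add \<Rightarrow> 'a" where
  "nmult 0 a = 0"
| "nmult (Suc k) a = a + nmult k a"

definition multiples :: "nat \<Rightarrow> 'a::ab_group_add \<Rightarrow> 'a set" where
  "multiples k a = (\<lambda>i. nmult i a) ` {1..k}"

definition add_subgroup :: "'a::ab_group_add set \<Rightarrow> bool" where
  "add_subgroup H \<longleftrightarrow> 0 \<in> H \<and> (\<forall>x\<in>H. \<forall>y\<in>H. x + y \<in> H) \<and> (\<forall>x\<in>H. - x \<in> H)"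

text \<open>The group \<open>G\<close> is the type \<open>'a\<close>.  The infimum of the empty set in
  \<^typ>\<open>enat\<close> is \<open>\<infinity>\<close>, so \<open>p(G) = \<infinity>\<close> if there is no nonzero finite subgroup.\<close>

definition min_subgroup_card :: "'a::ab_group_add itself \<Rightarrow> enat" where
  "min_subgroup_card _ =
     Inf {enat (card H) | H :: 'a set. add_subgroup H \<and> finite H \<and> H \<noteq> {0}}"

text \<open>The condition \<open>m < \<lceil>log\<^sub>2 p(G)\<rceil> / 2\<close>, which always holds if \<open>p(G) = \<infinity>\<close>.\<close>

definition small_for_group :: "'a::ab_group_add itself \<Rightarrow> nat \<Rightarrow> bool" where
  "small_for_group G m \<longleftrightarrow>
     (case min_subgroup_card G of
        enat q \<Rightarrow> real m < real_of_int \<lceil>log 2 (real q)\<rceil> / 2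
      | \<infinity> \<Rightarrow> True)"

section \<open>Orders\<close>

text \<open>As in \<^theory>\<open>HOL.Order_Relation\<close>, \<open>(x, y) \<in> r\<close> means \<open>x \<preceq> y\<close>.\<close>

definition compatible_order_on :: "'a::ab_group_add set \<Rightarrow> 'a rel \<Rightarrow> bool" where
  "compatible_order_on X r \<longleftrightarrow>
     linear_order_on X r \<and>
     (\<forall>x\<in>X. \<forall>y\<in>X. \<forall>z\<in>X. (x, y) \<in> r \<longrightarrow> x + z \<in> X \<longrightarrow> y + z \<in> X \<longrightarrow> (x + z, y + z) \<in> r)"

definition index_order :: "nat \<Rightarrow> 'a::ab_group_add \<Rightarrow> 'a rel" where
  "index_order m a = {(nmult j a, nmult k a) | j k. 1 \<le> j \<and> j \<le> k \<and> k \<le> m}"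

text \<open>The \<open>i\<close>-th smallest element of a finite set \<open>T\<close>, counting from 1.\<close>

definition nth_smallest :: "'a rel \<Rightarrow> 'a set \<Rightarrow> nat \<Rightarrow> 'a" where
  "nth_smallest r T i = (THE x. x \<in> T \<and> card {y \<in> T. (y, x) \<in> r} = i)"

section \<open>Matroids\<close>

record 'a matroid =
  ground :: "'a set"
  bases :: "'a set set"

definition is_matroid :: "'a matroid \<Rightarrow> bool" where
  "is_matroid M \<longleftrightarrow>
     finite (ground M) \<and> bases M \<noteq> {} \<and> (\<forall>B\<in>bases M. B \<subseteq> ground M) \<and>
     (\<forall>B\<in>bases M. \<forall>C\<in>bases M. \<forall>x\<in>B - C. \<exists>y\<in>C - B. insert y (B - {x}) \<in> bases M)"

definition matroid_isomorphic :: "'a matroid \<Rightarrow> 'b matroid \<Rightarrow> bool" where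
  "matroid_isomorphic M N \<longleftrightarrow>
     (\<exists>f. bij_betw f (ground M) (ground N) \<and>
          (\<forall>B. B \<subseteq> ground M \<longrightarrow> (B \<in> bases M \<longleftrightarrow> f ` B \<in> bases N)))"

definition uniform_matroid :: "nat \<Rightarrow> nat \<Rightarrow> nat matroid" where
  "uniform_matroid n m = \<lparr> ground = {1..m}, bases = {B. B \<subseteq> {1..m} \<and> card B = n} \<rparr>"

definition panhandle_matroid :: "nat \<Rightarrow> nat \<Rightarrow> nat \<Rightarrow> 'a::ab_group_add \<Rightarrow> 'a matroid" where
  "panhandle_matroid n s m a =
     \<lparr> ground = multiples m a,
       bases = {B. B \<subseteq> multiples m a \<and> card B = n \<and> card (B \<inter> multiples s a) \<ge> n - 1} \<rparr>"

text \<open>The ambient order \<open>r\<close> is used if \<open>a\<close> is positive, i.e. \<open>0 \<preceq> a\<close> (as \<open>a \<noteq> 0\<close>);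
  if \<open>a\<close> is negative, multiples \<open>k a\<close> are compared by the index \<open>k\<close>.\<close>

definition schubert_order :: "'a::ab_group_add rel \<Rightarrow> nat \<Rightarrow> 'a \<Rightarrow> 'a rel" where
  "schubert_order r m a = (if (0, a) \<in> r then r else index_order m a)"

definition schubert_matroid ::
    "'a::ab_group_add rel \<Rightarrow> nat \<Rightarrow> 'a \<Rightarrow> 'a set \<Rightarrow> 'a matroid" where
  "schubert_matroid r m a S =
     \<lparr> ground = multiples m a,
       bases = {T. T \<subseteq> multiples m a \<and> card T = card S \<and>
                   (\<forall>i\<in>{1..card S}. (nth_smallest (schubert_order r m a) T i,
                                     nth_smallest (schubert_order r m a) S i)
                                    \<in> schubert_order r m a)} \<rparr>"

section \<open>Matchings\<close>

text \<open>Ordered bases are lists without repetition, and bases are matched if they can be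
  ordered so that the ordered bases are.\<close>

definition ordered_bases_matched :: "'a::ab_group_add matroid \<Rightarrow> 'a list \<Rightarrow> 'a list \<Rightarrow> bool" where
  "ordered_bases_matched M as bs \<longleftrightarrow>
     length as = length bs \<and> (\<forall>i<length as. as ! i + bs ! i \<notin> ground M)"

definition basis_matched_to :: "'a::ab_group_add matroid \<Rightarrow> 'a set \<Rightarrow> 'a set \<Rightarrow> bool" where
  "basis_matched_to M A B \<longleftrightarrow>
     (\<exists>as bs. distinct as \<and> set as = A \<and> distinct bs \<and> set bs = B \<and>
              ordered_bases_matched M as bs)"

definition matched_to :: "'a::ab_group_add matroid \<Rightarrow> 'a matroid \<Rightarrow> bool" where
  "matched_to M N \<longleftrightarrow> (\<forall>A\<in>bases M. \<exists>B\<in>bases N. basis_matched_to M A B)"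

section \<open>Well-definedness\<close>

lemma nmult_add: "nmult (i + j) a = nmult i a + nmult j a"
  by (induction i) (auto simp: add.assoc)

lemma nmult_mult_zero: "nmult d a = 0 \<Longrightarrow> nmult (d * q) a = 0"
  by (induction q) (auto simp: nmult_add)

lemma nmult_mod: "nmult d a = 0 \<Longrightarrow> nmult (i mod d) a = nmult i a"
  by (metis add_0 mult_div_mod_eq nmult_add nmult_mult_zero)

lemma small_imp_nmult_nonzero:
  fixes a :: "'a::ab_group_add"
  assumes sm: "small_for_group TYPE('a) m" and a: "a \<noteq> 0" and d: "0 < d" "d \<le> 4 ^ m"
  shows "nmult d a \<noteq> 0"
proof
  assume 0: "nmult d a = 0"
  define H where "H = (\<lambda>i. nmult i a) ` {..<d}"
  have mem: "nmult i a \<in> H" for i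
    using nmult_mod[OF 0, of i] d unfolding H_def by (metis imageI lessThan_iff mod_less_divisor)
  have "- nmult i a \<in> H" if "i < d" for i
  proof -
    have "nmult (d - i) a + nmult i a = 0"
      using that 0 nmult_add[of "d - i" i a] by simp
    thus ?thesis using mem[of "d - i"] by (metis add_eq_0_iff2)
  qed
  hence "add_subgroup H"
    unfolding add_subgroup_def using mem mem[of 0] by (auto simp: H_def simp flip: nmult_add)
  moreover have "finite H" "card H \<le> d"
    unfolding H_def using card_image_le[of "{..<d}"] by auto
  moreover have "H \<noteq> {0}" using mem[of 1] a by auto
  ultimately have "min_subgroup_card TYPE('a) \<le> enat (card H)"
    unfolding min_subgroup_card_def by (intro Inf_lower) auto
  also have "\<dots> \<le> enat (4 ^ m)" using \<open>card H \<le> d\<close> d by simp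
  finally obtain q where q: "min_subgroup_card TYPE('a) = enat q" "q \<le> 4 ^ m"
    by (metis enat_ile enat_ord_simps(1))
  have lt: "real m < real_of_int \<lceil>log 2 (real q)\<rceil> / 2"
    using sm q unfolding small_for_group_def by simp
  have "log 2 (real q) \<le> real (2 * m)"
  proof (cases "q = 0")
    case False
    have "real q \<le> real (4 ^ m)" using q by (rule_tac of_nat_mono)
    also have "\<dots> = 2 powr real (2 * m)" by (subst powr_realpow) (auto simp: power_mult)
    finally show ?thesis using False by (simp add: log_le_iff)
  qed (auto simp: log_def)
  hence "\<lceil>log 2 (real q)\<rceil> \<le> int (2 * m)" by (simp add: ceiling_le_iff)
  hence "real_of_int \<lceil>log 2 (real q)\<rceil> \<le> real (2 * m)" by linarith
  with lt show False by simp
qed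

lemma four_mult_le_power: "4 * m \<le> (4::nat) ^ m"
proof (cases m)
  case (Suc k)
  have "Suc k \<le> 4 ^ k" by (induction k) auto
  thus ?thesis using Suc by simp
qed simp

lemma nmult_inj:
  fixes a :: "'a::ab_group_add"
  assumes "small_for_group TYPE('a) m" "a \<noteq> 0"
  shows "inj_on (\<lambda>i. nmult i a) {..4 * m}"
proof (rule linorder_inj_onI)
  fix i j assume "i < j" "i \<in> {..4*m}" "j \<in> {..4*m}"
  hence "nmult (j - i) a \<noteq> 0"
    using small_imp_nmult_nonzero[OF assms, of "j - i"] four_mult_le_power[of m] by auto
  thus "nmult i a \<noteq> nmult j a"
    using nmult_add[of "j - i" i a] \<open>i < j\<close> by auto
qed auto

text \<open>A compatible order exists under the standing condition on \<open>m\<close>.\<close>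

lemma compatible_order_exists:
  fixes a :: "'a::ab_group_add"
  assumes "small_for_group TYPE('a) m" "a \<noteq> 0"
  shows "\<exists>r. compatible_order_on (multiples (2 * m) a \<union> {0}) r"
proof -
  note inj = inj_onD[OF nmult_inj[OF assms]]
  define r where "r = {(nmult j a, nmult k a) | j k. j \<le> k \<and> k \<le> 2 * m}"
  have X: "multiples (2 * m) a \<union> {0} = (\<lambda>i. nmult i a) ` {..2 * m}"
  proof -
    have "{..2 * m} = insert 0 {1..2 * m}" by auto
    thus ?thesis unfolding multiples_def by simp
  qed
  have inj2: "i = j" if "nmult i a = nmult j a" "i \<le> 2 * m" "j \<le> 2 * m" for i j
    using inj[of i j] that by auto
  have r_iff: "(nmult j a, nmult k a) \<in> r \<longleftrightarrow> j \<le> k" if "j \<le> 2 * m" "k \<le> 2 * m" for j k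
  proof
    assume "(nmult j a, nmult k a) \<in> r"
    then obtain j' k' where *: "nmult j a = nmult j' a" "nmult k a = nmult k' a" "j' \<le> k'" "k' \<le> 2 * m"
      unfolding r_def by auto
    have "j = j'" "k = k'" using * that by (auto intro!: inj2)
    thus "j \<le> k" using * by simp
  qed (use that in \<open>auto simp: r_def\<close>)
  have rD: "\<exists>j k. x = nmult j a \<and> y = nmult k a \<and> j \<le> k \<and> k \<le> 2 * m" if "(x, y) \<in> r" for x y
    using that unfolding r_def by blast
  have "linear_order_on (multiples (2 * m) a \<union> {0}) r"
    unfolding X order_on_defs
  proof (intro conjI)
    show "r \<subseteq> (\<lambda>i. nmult i a) ` {..2 * m} \<times> (\<lambda>i. nmult i a) ` {..2 * m}"
      unfolding r_def by auto
    show "refl_on ((\<lambda>i. nmult i a) ` {..2 * m}) r"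
      by (auto simp: refl_on_def r_iff)
    show "total_on ((\<lambda>i. nmult i a) ` {..2 * m}) r"
      by (auto simp: total_on_def r_iff)
    show "antisym r"
    proof (rule antisymI)
      fix x y assume "(x, y) \<in> r" "(y, x) \<in> r"
      moreover from rD[OF this(1)] obtain j k
        where "x = nmult j a" "y = nmult k a" "j \<le> k" "k \<le> 2 * m" by auto
      ultimately show "x = y" by (auto simp: r_iff)
    qed
    show "trans r"
    proof (rule transI)
      fix x y z assume xy: "(x, y) \<in> r" and yz: "(y, z) \<in> r"
      from rD[OF xy] obtain j k where 1: "x = nmult j a" "y = nmult k a" "j \<le> k" "k \<le> 2 * m" by auto
      from rD[OF yz] obtain k' l where 2: "y = nmult k' a" "z = nmult l a" "k' \<le> l" "l \<le> 2 * m" by auto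
      have "k = k'" using 1 2 by (auto intro!: inj2)
      thus "(x, z) \<in> r" using 1 2 by (auto simp: r_iff)
    qed
  qed
  moreover have "(x + z, y + z) \<in> r"
    if h: "x \<in> multiples (2 * m) a \<union> {0}" "y \<in> multiples (2 * m) a \<union> {0}"
      "z \<in> multiples (2 * m) a \<union> {0}" "(x, y) \<in> r"
      "x + z \<in> multiples (2 * m) a \<union> {0}" "y + z \<in> multiples (2 * m) a \<union> {0}" for x y z
  proof -
    from h(4) rD obtain j k where 1: "x = nmult j a" "y = nmult k a" "j \<le> k" "k \<le> 2 * m" by blast
    from h(3,5,6)[unfolded X] obtain i u v where
      2: "z = nmult i a" "x + z = nmult u a" "y + z = nmult v a" "i \<le> 2*m" "u \<le> 2*m" "v \<le> 2*m"
      by auto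
    have "u = j + i" using 1 2 by (intro inj) (auto simp: nmult_add)
    moreover have "v = k + i" using 1 2 by (intro inj) (auto simp: nmult_add)
    ultimately show ?thesis using 1 2 by (simp add: r_iff)
  qed
  ultimately show ?thesis unfolding compatible_order_on_def by blast
qed

lemma index_order_linear:
  fixes a :: "'a::ab_group_add"
  assumes "small_for_group TYPE('a) m" "a \<noteq> 0"
  shows "linear_order_on (multiples m a) (index_order m a)"
proof -
  have inj: "i = j" if "nmult i a = nmult j a" "i \<le> m" "j \<le> m" for i j
    using inj_onD[OF nmult_inj[OF assms], of i j] that by auto
  have iff: "(nmult j a, nmult k a) \<in> index_order m a \<longleftrightarrow> j \<le> k"
    if "1 \<le> j" "j \<le> m" "1 \<le> k" "k \<le> m" for j k
  proof
    assume "(nmult j a, nmult k a) \<in> index_order m a"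
    then obtain j' k' where *: "nmult j a = nmult j' a" "nmult k a = nmult k' a" "j' \<le> k'" "k' \<le> m"
      unfolding index_order_def by auto
    have "j = j'" "k = k'" using * that by (auto intro!: inj)
    thus "j \<le> k" using * by simp
  qed (use that in \<open>auto simp: index_order_def\<close>)
  have D: "\<exists>j k. x = nmult j a \<and> y = nmult k a \<and> 1 \<le> j \<and> j \<le> k \<and> k \<le> m"
    if "(x, y) \<in> index_order m a" for x y
    using that unfolding index_order_def by blast
  show ?thesis
    unfolding order_on_defs
  proof (intro conjI)
    show "index_order m a \<subseteq> multiples m a \<times> multiples m a"
      unfolding index_order_def multiples_def by auto
    show "refl_on (multiples m a) (index_order m a)"
      by (auto simp: refl_on_def multiples_def iff)
    show "total_on (multiples m a) (index_order m a)"
      by (auto simp: total_on_def multiples_def iff)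
    show "antisym (index_order m a)"
    proof (rule antisymI)
      fix x y assume xy: "(x, y) \<in> index_order m a" and yx: "(y, x) \<in> index_order m a"
      from D[OF xy] obtain j k
        where *: "x = nmult j a" "y = nmult k a" "1 \<le> j" "j \<le> k" "k \<le> m" by auto
      with yx have "k \<le> j" by (auto simp: iff)
      with * show "x = y" by simp
    qed
    show "trans (index_order m a)"
    proof (rule transI)
      fix x y z assume xy: "(x, y) \<in> index_order m a" and yz: "(y, z) \<in> index_order m a"
      from D[OF xy] obtain j k where 1: "x = nmult j a" "y = nmult k a" "1 \<le> j" "j \<le> k" "k \<le> m" by auto
      from D[OF yz] obtain k' l where 2: "y = nmult k' a" "z = nmult l a" "k' \<le> l" "l \<le> m" by auto
      have "k = k'" using 1 2 by (auto intro!: inj)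
      thus "(x, z) \<in> index_order m a" using 1 2 by (auto simp: iff)
    qed
  qed
qed

text \<open>The linearly ordered sets below may be larger than the sets whose elements are enumerated.\<close>

context
  fixes A :: "'a set" and r :: "'a rel"
  assumes lin: "linear_order_on A r"
begin

lemma ord_refl: "x \<in> A \<Longrightarrow> (x, x) \<in> r"
  using lin by (auto simp: order_on_defs refl_on_def)

lemma ord_trans: "(x, y) \<in> r \<Longrightarrow> (y, z) \<in> r \<Longrightarrow> (x, z) \<in> r"
  using lin by (auto simp: order_on_defs dest: transD)

lemma ord_antisym: "(x, y) \<in> r \<Longrightarrow> (y, x) \<in> r \<Longrightarrow> x = y"
  using lin by (auto simp: order_on_defs dest: antisymD)

lemma ord_total: "x \<in> A \<Longrightarrow> y \<in> A \<Longrightarrow> (x, y) \<in> r \<or> (y, x) \<in> r"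
  using lin ord_refl[of x] by (cases "x = y") (auto simp: order_on_defs total_on_def)

lemma card_below_less:
  assumes "finite T" "T \<subseteq> A" "x \<in> A" "t \<in> T" "(t, x) \<notin> r"
  shows "card {y \<in> T. (y, x) \<in> r} < card {y \<in> T. (y, t) \<in> r}"
proof (rule psubset_card_mono)
  have "(x, t) \<in> r" using assms ord_total by blast
  thus "{y \<in> T. (y, x) \<in> r} \<subset> {y \<in> T. (y, t) \<in> r}"
    using assms ord_trans ord_refl by blast
qed (use assms in auto)

lemma nth_smallest:
  assumes "finite T" "T \<subseteq> A" "i \<in> {1..card T}"
  shows "nth_smallest r T i \<in> T" "card {y \<in> T. (y, nth_smallest r T i) \<in> r} = i"
proof -
  let ?f = "\<lambda>x. card {y \<in> T. (y, x) \<in> r}"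
  have inj: "inj_on ?f T"
  proof (rule inj_onI)
    fix x y assume "x \<in> T" "y \<in> T" "?f x = ?f y"
    thus "x = y"
      using card_below_less[of T x y] card_below_less[of T y x] assms ord_antisym by fastforce
  qed
  have "?f ` T \<subseteq> {1..card T}"
  proof
    fix k assume "k \<in> ?f ` T"
    then obtain x where x: "x \<in> T" "k = ?f x" by auto
    have "{y \<in> T. (y, x) \<in> r} \<noteq> {}" using x assms ord_refl by blast
    hence "k > 0" using x assms by (simp add: card_gt_0_iff)
    moreover have "k \<le> card T" using x assms by (auto intro: card_mono)
    ultimately show "k \<in> {1..card T}" by simp
  qed
  hence "?f ` T = {1..card T}"
    by (rule card_subset_eq[rotated]) (auto simp: card_image[OF inj])
  then obtain x where x: "x \<in> T" "?f x = i" using assms by (metis (no_types, lifting) imageE)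
  have "nth_smallest r T i = x"
    unfolding nth_smallest_def using x inj by (intro the_equality) (auto dest: inj_onD)
  thus "nth_smallest r T i \<in> T" "?f (nth_smallest r T i) = i" using x by auto
qed

lemma nth_smallest_le_iff:
  assumes "finite T" "T \<subseteq> A" "i \<in> {1..card T}" "x \<in> A"
  shows "(nth_smallest r T i, x) \<in> r \<longleftrightarrow> i \<le> card {y \<in> T. (y, x) \<in> r}"
proof
  note n = nth_smallest[OF assms(1-3)]
  assume le: "(nth_smallest r T i, x) \<in> r"
  have "card {y \<in> T. (y, nth_smallest r T i) \<in> r} \<le> card {y \<in> T. (y, x) \<in> r}"
    using assms(1) le ord_trans by (intro card_mono) auto
  thus "i \<le> card {y \<in> T. (y, x) \<in> r}" using n by simp
next
  note n = nth_smallest[OF assms(1-3)]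
  assume "i \<le> card {y \<in> T. (y, x) \<in> r}"
  thus "(nth_smallest r T i, x) \<in> r"
    using card_below_less[OF assms(1,2,4) n(1)] n(2) by linarith
qed

lemma dominated_iff:
  assumes "finite T" "T \<subseteq> A" "finite S" "S \<subseteq> A" "card T = card S"
  shows "(\<forall>i\<in>{1..card S}. (nth_smallest r T i, nth_smallest r S i) \<in> r) \<longleftrightarrow>
         (\<forall>x\<in>A. card {y \<in> S. (y, x) \<in> r} \<le> card {y \<in> T. (y, x) \<in> r})" (is "?L \<longleftrightarrow> ?R")
proof
  assume L: ?L
  show ?R
  proof
    fix x assume x: "x \<in> A"
    let ?i = "card {y \<in> S. (y, x) \<in> r}"
    show "?i \<le> card {y \<in> T. (y, x) \<in> r}"
    proof (cases "?i = 0")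
      case False
      have "?i \<le> card S" using assms by (auto intro: card_mono)
      with False have i: "?i \<in> {1..card S}" by simp
      hence "(nth_smallest r S ?i, x) \<in> r" using nth_smallest_le_iff[of S ?i x] assms x by simp
      hence "(nth_smallest r T ?i, x) \<in> r" using L i ord_trans by blast
      thus ?thesis using nth_smallest_le_iff[of T ?i x] assms x i by simp
    qed simp
  qed
next
  assume R: ?R
  show ?L
  proof
    fix i assume i: "i \<in> {1..card S}"
    note n = nth_smallest[OF assms(3,4) i]
    hence A: "nth_smallest r S i \<in> A" using assms by auto
    with R n have "i \<le> card {y \<in> T. (y, nth_smallest r S i) \<in> r}" by force
    thus "(nth_smallest r T i, nth_smallest r S i) \<in> r"
      using nth_smallest_le_iff[of T i] assms i A by simp
  qed
qed

lemma dominated_exchange: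
  assumes B: "finite B" "B \<subseteq> A" and C: "finite C" "C \<subseteq> A" "card C = card B"
    and S: "\<And>x. x \<in> A \<Longrightarrow> card {y \<in> S. (y, x) \<in> r} \<le> card {y \<in> B. (y, x) \<in> r}"
      "\<And>x. x \<in> A \<Longrightarrow> card {y \<in> S. (y, x) \<in> r} \<le> card {y \<in> C. (y, x) \<in> r}"
    and b: "b \<in> B - C"
  shows "\<exists>c\<in>C - B. \<forall>x\<in>A. card {y \<in> S. (y, x) \<in> r} \<le> card {y \<in> insert c (B - {b}). (y, x) \<in> r}"
proof -
  have "\<not> C \<subseteq> B" using b B C card_subset_eq[of B C] by auto
  hence ne: "1 \<in> {1..card (C - B)}" using C by (simp add: Suc_le_eq card_gt_0_iff)
  define c where "c = nth_smallest r (C - B) 1"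
  have fin: "finite (C - B)" "C - B \<subseteq> A" using C by auto
  have c: "c \<in> C - B" "card {y \<in> C - B. (y, c) \<in> r} = 1"
    using nth_smallest[OF fin ne] unfolding c_def by auto
  have cA: "c \<in> A" using c fin by auto
  have "card {y \<in> S. (y, x) \<in> r} \<le> card {y \<in> insert c (B - {b}). (y, x) \<in> r}" if x: "x \<in> A" for x
  proof (cases "(c, x) \<in> r")
    case True
    let ?D = "{y \<in> B. (y, x) \<in> r}"
    have "insert c (?D - {b}) \<subseteq> {y \<in> insert c (B - {b}). (y, x) \<in> r}" using True by auto
    hence "card (insert c (?D - {b})) \<le> card {y \<in> insert c (B - {b}). (y, x) \<in> r}"
      using B by (intro card_mono) auto
    moreover have "card ?D \<le> card (insert c (?D - {b}))"
      using c B by (cases "b \<in> ?D") (auto simp: card_insert_if)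
    ultimately show ?thesis using S(1)[OF x] by linarith
  next
    case False
    have "{y \<in> C. (y, x) \<in> r} \<subseteq> {y \<in> insert c (B - {b}). (y, x) \<in> r}"
    proof
      fix y assume y: "y \<in> {y \<in> C. (y, x) \<in> r}"
      have "y \<in> B"
      proof (rule ccontr)
        assume "y \<notin> B"
        with y have "{z \<in> C - B. (z, x) \<in> r} \<noteq> {}" by blast
        hence "card {z \<in> C - B. (z, x) \<in> r} > 0" using C(1) by (subst card_gt_0_iff) simp
        thus False using card_below_less[OF fin x c(1) False] c(2) by linarith
      qed
      thus "y \<in> {y \<in> insert c (B - {b}). (y, x) \<in> r}" using y b by auto
    qed
    hence "card {y \<in> C. (y, x) \<in> r} \<le> card {y \<in> insert c (B - {b}). (y, x) \<in> r}"
      using B by (intro card_mono) auto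
    with S(2)[OF x] show ?thesis by linarith
  qed
  with c show ?thesis by blast
qed

end

lemma finite_multiples [simp]: "finite (multiples k a)"
  by (simp add: multiples_def)

lemma card_multiples:
  fixes a :: "'a::ab_group_add"
  assumes "small_for_group TYPE('a) m" "a \<noteq> 0" "k \<le> m"
  shows "card (multiples k a) = k"
proof -
  have "inj_on (\<lambda>i. nmult i a) {1..k}"
    by (rule inj_on_subset[OF nmult_inj[OF assms(1,2)]]) (use assms(3) in auto)
  thus ?thesis unfolding multiples_def by (simp add: card_image)
qed

lemma schubert_is_matroid:
  fixes a :: "'a::ab_group_add"
  assumes sm: "small_for_group TYPE('a) m" "a \<noteq> 0"
    and r: "compatible_order_on (multiples (2 * m) a \<union> {0}) r"
    and S: "S \<subseteq> multiples m a"
  shows "is_matroid (schubert_matroid r m a S)"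
proof -
  define r' where "r' = schubert_order r m a"
  define E where "E = multiples m a"
  have sub: "E \<subseteq> multiples (2 * m) a \<union> {0}" unfolding E_def multiples_def by auto
  obtain A where A: "linear_order_on A r'" "E \<subseteq> A"
  proof (cases "(0, a) \<in> r")
    case True
    thus ?thesis
      using that[of "multiples (2 * m) a \<union> {0}"] r sub
      unfolding r'_def schubert_order_def compatible_order_on_def by simp
  next
    case False
    thus ?thesis using that[of E] index_order_linear[OF sm]
      unfolding r'_def schubert_order_def E_def by simp
  qed
  have fin: "finite T" "T \<subseteq> A" if "T \<subseteq> E" for T
    using that A finite_subset[OF that] by (auto simp: E_def)
  have SE: "S \<subseteq> E" using S by (simp add: E_def)
  have bases_iff: "T \<in> bases (schubert_matroid r m a S) \<longleftrightarrow>
    T \<subseteq> E \<and> card T = card S \<and> (\<forall>x\<in>A. card {y \<in> S. (y, x) \<in> r'} \<le> card {y \<in> T. (y, x) \<in> r'})" for T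
    using dominated_iff[OF A(1) fin(1) fin(2) fin(1)[OF SE] fin(2)[OF SE], of T]
    unfolding schubert_matroid_def r'_def[symmetric] E_def[symmetric] by auto
  have ground: "ground (schubert_matroid r m a S) = E"
    by (simp add: schubert_matroid_def E_def)
  show ?thesis
    unfolding is_matroid_def ground
  proof (intro conjI ballI)
    show "finite E" by (simp add: E_def)
    have "S \<in> bases (schubert_matroid r m a S)" using SE by (simp add: bases_iff)
    thus "bases (schubert_matroid r m a S) \<noteq> {}" by blast
    show "B \<subseteq> E" if "B \<in> bases (schubert_matroid r m a S)" for B
      using that by (simp add: bases_iff)
    fix B C b
    assume BC: "B \<in> bases (schubert_matroid r m a S)" "C \<in> bases (schubert_matroid r m a S)"
      and b: "b \<in> B - C"
    then obtain c where c: "c \<in> C - B"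
      "\<forall>x\<in>A. card {y \<in> S. (y, x) \<in> r'} \<le> card {y \<in> insert c (B - {b}). (y, x) \<in> r'}"
      using dominated_exchange[OF A(1), of B C S b] fin[of B] fin[of C]
      by (auto simp: bases_iff)
    have "card (insert c (B - {b})) = card B"
      using c b BC fin(1)[of B] card_Suc_Diff1[of B b] by (auto simp: bases_iff)
    with c BC have "insert c (B - {b}) \<in> bases (schubert_matroid r m a S)"
      by (auto simp: bases_iff)
    with c show "\<exists>c\<in>C - B. insert c (B - {b}) \<in> bases (schubert_matroid r m a S)" by blast
  qed
qed

lemma panhandle_is_matroid:
  fixes a :: "'a::ab_group_add"
  assumes sm: "small_for_group TYPE('a) m" "a \<noteq> 0" and n: "n \<le> s" "s < m"
  shows "is_matroid (panhandle_matroid n s m a)"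
proof -
  define E where "E = multiples m a"
  define F where "F = multiples s a"
  have FE: "F \<subseteq> E" unfolding E_def F_def multiples_def using n by auto
  have finE: "finite E" "finite F" by (auto simp: E_def F_def)
  have bases_iff: "T \<in> bases (panhandle_matroid n s m a) \<longleftrightarrow>
      T \<subseteq> E \<and> card T = n \<and> n - 1 \<le> card (T \<inter> F)" for T
    by (simp add: panhandle_matroid_def E_def F_def)
  have ground: "ground (panhandle_matroid n s m a) = E"
    by (simp add: panhandle_matroid_def E_def)
  show ?thesis
    unfolding is_matroid_def ground
  proof (intro conjI ballI)
    show "finite E" by (fact finE)
    have "card F = s" unfolding F_def using card_multiples[OF sm] n by simp
    then obtain B where "B \<subseteq> F" "card B = n" using n obtain_subset_with_card_n by metis
    hence "B \<in> bases (panhandle_matroid n s m a)"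
      using FE by (auto simp: bases_iff Int_absorb2)
    thus "bases (panhandle_matroid n s m a) \<noteq> {}" by blast
    show "B \<subseteq> E" if "B \<in> bases (panhandle_matroid n s m a)" for B
      using that by (simp add: bases_iff)
    fix B C b
    assume BC: "B \<in> bases (panhandle_matroid n s m a)" "C \<in> bases (panhandle_matroid n s m a)"
      and b: "b \<in> B - C"
    have fin: "finite B" "finite C" using BC finE by (auto simp: bases_iff intro: finite_subset)
    have cardBC: "card B = n" "card C = n" using BC by (auto simp: bases_iff)
    have cb: "card (insert c (B - {b})) = n" if "c \<in> C - B" for c
      using that b cardBC fin card_Suc_Diff1[of B b] by auto
    have swap: "insert c (B - {b}) \<in> bases (panhandle_matroid n s m a)"
      if "c \<in> C - B" "n - 1 \<le> card (insert c (B - {b}) \<inter> F)" for c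
      using that cb BC by (auto simp: bases_iff)
    have "\<not> C \<subseteq> B" using b fin cardBC card_subset_eq[of B C] by auto
    then obtain c0 where c0: "c0 \<in> C - B" by blast
    show "\<exists>c\<in>C - B. insert c (B - {b}) \<in> bases (panhandle_matroid n s m a)"
    proof (cases "\<exists>c\<in>C - B. c \<in> F")
      case True
      then obtain c where c: "c \<in> C - B" "c \<in> F" by blast
      have "insert c ((B \<inter> F) - {b}) = insert c (B - {b}) \<inter> F" using c by auto
      moreover have "card (B \<inter> F) \<le> card (insert c ((B \<inter> F) - {b}))"
        using c fin by (cases "b \<in> B \<inter> F") (auto simp: card_insert_if)
      ultimately show ?thesis using swap[OF c(1)] c BC by (auto simp: bases_iff)
    next
      case False
      hence CF: "C \<inter> F \<subseteq> (B - {b}) \<inter> F" using b by auto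
      have "card (C \<inter> F) \<le> card (insert c0 (B - {b}) \<inter> F)"
        using CF fin by (intro card_mono) auto
      thus ?thesis using swap[OF c0] c0 BC by (auto simp: bases_iff)
    qed
  qed
qed

end

theory Submission
  imports Defs
begin

text \<open>On \<open>{a, \<dots>, m a}\<close> the order is that of the indices, and \<open>i a + j a\<close> leaves this set
  iff \<open>i + j > m\<close>.  The lowest \<open>n\<close>-set \<open>{a, \<dots>, n a}\<close> is a basis of \<open>M\<close> in both cases, and
  it can only be matched to the highest one, \<open>{(m - n + 1) a, \<dots>, m a}\<close>; conversely every
  \<open>n\<close>-set is matched to the highest one by pairing increasingly sorted elements with
  decreasing ones.  So \<open>M\<close> is matched to a Schubert matroid iff the highest \<open>n\<close>-set is one of
  its bases, which means that every \<open>n\<close>-set is.\<close>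

section \<open>Counting the elements below a threshold\<close>

text \<open>If some \<open>u\<close> in \<open>U\<close> is at most \<open>x\<close>, then so is
  every element of \<open>T - U\<close>, by transitivity through \<open>u\<close>. If there is no
  such \<open>u\<close>, the left count is 0.\<close>

lemma count_below_upper_segment_le:
  assumes lin: "linear_order_on A r"
    and fin: "finite U" "finite T" and card: "card U = card T"
    and upper: "\<And>t u. t \<in> T \<Longrightarrow> t \<notin> U \<Longrightarrow> u \<in> U \<Longrightarrow> (t, u) \<in> r"
  shows "card {y \<in> U. (y, x) \<in> r} \<le> card {y \<in> T. (y, x) \<in> r}"
proof (cases "{y \<in> U. (y, x) \<in> r} = {}")
  case False
  then obtain u where u: "u \<in> U" "(u, x) \<in> r" by blast
  have "(t, x) \<in> r" if "t \<in> T" "t \<notin> U" for t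
    using ord_trans[OF lin upper[OF that u(1)] u(2)] .
  \<comment> \<open>All elements of \<open>T\<close> that are not at most \<open>x\<close> lie in
    \<open>U\<close>. As \<open>U\<close> and \<open>T\<close> have equal size, this inequality
    between the complements reverses to the claim.\<close>
  hence "card {y \<in> T. (y, x) \<notin> r} \<le> card {y \<in> U. (y, x) \<notin> r}"
    using fin by (intro card_mono) auto
  moreover have split: "card V = card {y \<in> V. (y, x) \<in> r} + card {y \<in> V. (y, x) \<notin> r}"
    if "finite V" for V
    using that by (subst card_Un_disjoint[symmetric]) (auto intro: arg_cong[where f = card])
  ultimately show ?thesis using split[OF fin(1)] split[OF fin(2)] card by linarith
qed (simp only: card.empty le0)

text \<open>If some \<open>l\<close> in \<open>L\<close> is not at most \<open>x\<close>, then no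
  element of \<open>T - L\<close> is either, since it dominates \<open>l\<close>. Otherwise the
  right count is all of \<open>card L = card T\<close>.\<close>

lemma count_below_le_lower_segment:
  assumes lin: "linear_order_on A r"
    and fin: "finite L" "finite T" and card: "card T = card L"
    and lower: "\<And>l t. l \<in> L \<Longrightarrow> t \<in> T \<Longrightarrow> t \<notin> L \<Longrightarrow> (l, t) \<in> r"
  shows "card {y \<in> T. (y, x) \<in> r} \<le> card {y \<in> L. (y, x) \<in> r}"
proof (cases "\<forall>l\<in>L. (l, x) \<in> r")
  case True
  hence "{y \<in> L. (y, x) \<in> r} = L" by auto
  moreover have "card {y \<in> T. (y, x) \<in> r} \<le> card T" using fin by (intro card_mono) auto
  ultimately show ?thesis using card by simp
next
  case False
  then obtain l where l: "l \<in> L" "(l, x) \<notin> r" by blast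
  have "{y \<in> T. (y, x) \<in> r} \<subseteq> {y \<in> L. (y, x) \<in> r}"
    using l lower ord_trans[OF lin] by blast
  thus ?thesis using fin by (intro card_mono) auto
qed

section \<open>The order on the multiples of \<open>a\<close>\<close>

text \<open>Adding \<open>nmult k a\<close> to \<open>0 \<le> a\<close> compares consecutive
  multiples, as long as both sums stay in the ordered set; transitivity chains these
  comparisons.\<close>

lemma compatible_order_nmult_le:
  assumes r: "compatible_order_on (multiples (2 * m) a \<union> {0}) r" and pos: "(0, a) \<in> r"
    and ij: "i \<le> j" "j \<le> 2 * m"
  shows "(nmult i a, nmult j a) \<in> r"
proof -
  define X where "X = multiples (2 * m) a \<union> {0}"
  have lin: "linear_order_on X r" using r by (simp add: compatible_order_on_def X_def)
  have X: "nmult k a \<in> X" if "k \<le> 2 * m" for k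
    using that by (cases "k = 0") (auto simp: X_def multiples_def)
  have suc: "(nmult k a, nmult (Suc k) a) \<in> r" if "Suc k \<le> 2 * m" for k
  proof -
    have "a \<in> X" using X[of 1] that by simp
    have "x + z \<in> X \<Longrightarrow> y + z \<in> X \<Longrightarrow> (x + z, y + z) \<in> r"
      if "x \<in> X" "y \<in> X" "z \<in> X" "(x, y) \<in> r" for x y z
      using r that unfolding compatible_order_on_def X_def by blast
    from this[OF _ \<open>a \<in> X\<close> _ pos, of "nmult k a"] X[of 0] X[of k] X[of "Suc k"] that
    show ?thesis by simp
  qed
  from ij show ?thesis
  proof (induction j rule: dec_induct)
    case base
    thus ?case using ord_refl[OF lin X[of i]] by simp
  next
    case (step k)
    thus ?case using ord_trans[OF lin, of "nmult i a" "nmult k a"] suc[of k] by simp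
  qed
qed

text \<open>Treats positive and negative \<open>a\<close> uniformly. The carrier \<open>A\<close>
  differs between the two cases, but on \<open>multiples m a\<close> the order follows the indices
  in both.\<close>

lemma schubert_order_extends_index:
  fixes a :: "'a::ab_group_add"
  assumes sm: "small_for_group TYPE('a) m" "a \<noteq> 0"
    and r: "compatible_order_on (multiples (2 * m) a \<union> {0}) r"
  obtains A where "linear_order_on A (schubert_order r m a)" "multiples m a \<subseteq> A"
    "\<And>i j. 1 \<le> i \<Longrightarrow> i \<le> j \<Longrightarrow> j \<le> m \<Longrightarrow> (nmult i a, nmult j a) \<in> schubert_order r m a"
proof (cases "(0, a) \<in> r")
  case True
  have "multiples m a \<subseteq> multiples (2 * m) a \<union> {0}" by (auto simp: multiples_def)
  with True show ?thesis
    using that[of "multiples (2 * m) a \<union> {0}"] r compatible_order_nmult_le[OF r True]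
    by (simp add: schubert_order_def compatible_order_on_def)
next
  case False
  thus ?thesis using that[of "multiples m a"] index_order_linear[OF sm]
    by (auto simp: schubert_order_def index_order_def)
qed

section \<open>Bases by counting, and the lowest basis\<close>

text \<open>Trades the comparison of i-th smallest elements for a comparison of counts at each
  threshold, the form to which the two counting lemmas apply.\<close>

lemma schubert_bases_iff:
  assumes lin: "linear_order_on A (schubert_order r m a)" and A: "multiples m a \<subseteq> A"
    and S: "S \<subseteq> multiples m a"
  shows "T \<in> bases (schubert_matroid r m a S) \<longleftrightarrow>
    T \<subseteq> multiples m a \<and> card T = card S \<and>
    (\<forall>x\<in>A. card {y \<in> S. (y, x) \<in> schubert_order r m a}
          \<le> card {y \<in> T. (y, x) \<in> schubert_order r m a})"
proof -
  have fin: "finite V" if "V \<subseteq> multiples m a" for V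
    using that finite_multiples finite_subset by blast
  show ?thesis
    using dominated_iff[OF lin fin _ fin[OF S], of T] A S
    by (auto simp: schubert_matroid_def)
qed

text \<open>An element of \<open>S\<close> outside the initial segment has index above
  \<open>card S\<close>, hence dominates the whole segment.\<close>

lemma lowest_basis_schubert:
  fixes a :: "'a::ab_group_add"
  assumes sm: "small_for_group TYPE('a) m" "a \<noteq> 0"
    and r: "compatible_order_on (multiples (2 * m) a \<union> {0}) r"
    and S: "S \<subseteq> multiples m a" "card S \<le> m"
  shows "multiples (card S) a \<in> bases (schubert_matroid r m a S)"
proof -
  obtain A where A: "linear_order_on A (schubert_order r m a)" "multiples m a \<subseteq> A"
    and le: "\<And>i j. 1 \<le> i \<Longrightarrow> i \<le> j \<Longrightarrow> j \<le> m \<Longrightarrow> (nmult i a, nmult j a) \<in> schubert_order r m a"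
    by (rule schubert_order_extends_index[OF sm r]) blast
  let ?L = "multiples (card S) a"
  have L: "?L \<subseteq> multiples m a" using S by (auto simp: multiples_def)
  have card: "card ?L = card S" by (rule card_multiples[OF sm S(2)])
  have lower: "(l, t) \<in> schubert_order r m a" if "l \<in> ?L" "t \<in> S" "t \<notin> ?L" for l t
  proof -
    from \<open>l \<in> ?L\<close> obtain i where i: "l = nmult i a" "1 \<le> i" "i \<le> card S"
      by (auto simp: multiples_def)
    from \<open>t \<in> S\<close> S obtain j where j: "t = nmult j a" "1 \<le> j" "j \<le> m"
      by (auto simp: multiples_def)
    with \<open>t \<notin> ?L\<close> have "\<not> j \<le> card S" by (auto simp: multiples_def)
    with i j show ?thesis by (auto intro: le)
  qed
  have "finite S" using S finite_multiples finite_subset by blast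
  with A S L card lower show ?thesis
    by (auto simp: schubert_bases_iff[OF A S(1)] intro!: count_below_le_lower_segment[OF A(1)])
qed

lemma lowest_basis_panhandle:
  fixes a :: "'a::ab_group_add"
  assumes sm: "small_for_group TYPE('a) m" "a \<noteq> 0" and n: "n \<le> s" "s \<le> m"
  shows "multiples n a \<in> bases (panhandle_matroid n s m a)"
proof -
  have "multiples n a \<subseteq> multiples s a" "multiples n a \<subseteq> multiples m a"
    using n by (auto simp: multiples_def)
  thus ?thesis using n card_multiples[OF sm, of n]
    by (simp add: panhandle_matroid_def Int_absorb2)
qed

section \<open>The highest n-set and uniformity\<close>

text \<open>For \<open>n \<le> m\<close> the interval holds exactly \<open>n\<close> indices. For
  \<open>n > m\<close> the subtraction truncates to 0 and the set is all of
  \<open>multiples m a\<close>.\<close>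

definition top_multiples :: "nat \<Rightarrow> nat \<Rightarrow> 'a::ab_group_add \<Rightarrow> 'a set" where
  "top_multiples n m a = (\<lambda>i. nmult i a) ` {m - n<..m}"

lemma top_multiples_subset: "top_multiples n m a \<subseteq> multiples m a"
  by (auto simp: top_multiples_def multiples_def)

lemma card_top_multiples:
  fixes a :: "'a::ab_group_add"
  assumes "small_for_group TYPE('a) m" "a \<noteq> 0" "n \<le> m"
  shows "card (top_multiples n m a) = n"
proof -
  have "inj_on (\<lambda>i. nmult i a) {m - n<..m}"
    by (rule inj_on_subset[OF nmult_inj[OF assms(1,2)]]) auto
  thus ?thesis using assms(3) by (simp add: top_multiples_def card_image)
qed

text \<open>Among sets of its size, the highest one has the fewest elements below each threshold. If
  even it has as many as \<open>S\<close>, so does every \<open>T\<close>.\<close>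

lemma schubert_uniform_if_top_basis:
  fixes a :: "'a::ab_group_add"
  assumes sm: "small_for_group TYPE('a) m" "a \<noteq> 0"
    and r: "compatible_order_on (multiples (2 * m) a \<union> {0}) r"
    and S: "S \<subseteq> multiples m a"
    and top: "top_multiples n m a \<in> bases (schubert_matroid r m a S)"
    and T: "T \<subseteq> multiples m a" "card T = card S"
  shows "T \<in> bases (schubert_matroid r m a S)"
proof -
  obtain A where A: "linear_order_on A (schubert_order r m a)" "multiples m a \<subseteq> A"
    and le: "\<And>i j. 1 \<le> i \<Longrightarrow> i \<le> j \<Longrightarrow> j \<le> m \<Longrightarrow> (nmult i a, nmult j a) \<in> schubert_order r m a"
    by (rule schubert_order_extends_index[OF sm r]) blast
  let ?U = "top_multiples n m a"
  note iff = schubert_bases_iff[OF A S]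
  have U: "?U \<subseteq> multiples m a" "card ?U = card S"
    using top by (auto simp: iff)
  have fin: "finite ?U" "finite T" using T U finite_multiples finite_subset by blast+
  have upper: "(t, u) \<in> schubert_order r m a" if "t \<in> T" "t \<notin> ?U" "u \<in> ?U" for t u
  proof -
    from \<open>t \<in> T\<close> T obtain i where i: "t = nmult i a" "1 \<le> i" "i \<le> m"
      by (auto simp: multiples_def)
    from \<open>u \<in> ?U\<close> obtain j where j: "u = nmult j a" "m - n < j" "j \<le> m"
      by (auto simp: top_multiples_def)
    from \<open>t \<notin> ?U\<close> i have "\<not> m - n < i" by (auto simp: top_multiples_def)
    with i j show ?thesis by (auto intro: le)
  qed
  have "card {y \<in> ?U. (y, x) \<in> schubert_order r m a}
      \<le> card {y \<in> T. (y, x) \<in> schubert_order r m a}" for x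
    using count_below_upper_segment_le[OF A(1) fin _ upper] U T by simp
  with top T show ?thesis unfolding iff by (meson order_trans)
qed

text \<open>A bijection preserves the sizes of subsets, so being the preimage of a basis of the
  uniform matroid depends on size alone.\<close>

lemma isomorphic_uniform_iff:
  assumes fin: "finite (ground M)" and card: "card (ground M) = m"
    and M: "\<And>B. B \<in> bases M \<Longrightarrow> B \<subseteq> ground M \<and> card B = n"
  shows "matroid_isomorphic M (uniform_matroid n m) \<longleftrightarrow>
    (\<forall>B. B \<subseteq> ground M \<longrightarrow> card B = n \<longrightarrow> B \<in> bases M)" (is "?L \<longleftrightarrow> ?R")
proof
  assume ?L
  then obtain f where f: "bij_betw f (ground M) {1..m}"
    and b: "\<And>B. B \<subseteq> ground M \<Longrightarrow> B \<in> bases M \<longleftrightarrow> f ` B \<subseteq> {1..m} \<and> card (f ` B) = n"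
    by (auto simp: matroid_isomorphic_def uniform_matroid_def)
  show ?R
    using b f by (metis bij_betw_def card_image image_mono inj_on_subset)
next
  assume R: ?R
  \<comment> \<open>Any bijection of the ground sets serves as the isomorphism.\<close>
  obtain f where f: "bij_betw f (ground M) {1..m}"
    using finite_same_card_bij[OF fin, of "{1..m}"] card by auto
  have "B \<in> bases M \<longleftrightarrow> f ` B \<in> bases (uniform_matroid n m)" if "B \<subseteq> ground M" for B
  proof -
    have "f ` B \<subseteq> {1..m}" "card (f ` B) = card B"
      using f that by (auto simp: bij_betw_def intro: card_image inj_on_subset)
    thus ?thesis using R M[of B] that by (auto simp: uniform_matroid_def)
  qed
  with f show ?L by (auto simp: matroid_isomorphic_def uniform_matroid_def)
qed

section \<open>Matching with the highest n-set\<close>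

text \<open>Excludes wrap-around in the group: a sum of two ground elements has index at most
  \<open>2 * m\<close>, within the range where \<open>nmult_inj\<close> gives injectivity.\<close>

lemma nmult_notin_multiples:
  fixes a :: "'a::ab_group_add"
  assumes sm: "small_for_group TYPE('a) m" "a \<noteq> 0" and k: "m < k" "k \<le> 4 * m"
  shows "nmult k a \<notin> multiples m a"
proof
  assume "nmult k a \<in> multiples m a"
  then obtain i where "nmult k a = nmult i a" "i \<le> m" by (auto simp: multiples_def)
  with inj_onD[OF nmult_inj[OF sm], of k i] k show False by auto
qed

text \<open>Counting from 0, the \<open>i\<close>-th index of \<open>B\<close> in increasing order
  is at least \<open>i + 1\<close>. Its partner has index \<open>m - i\<close>, so the sum exceeds
  \<open>m\<close>.\<close>

lemma basis_matched_to_top: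
  fixes a :: "'a::ab_group_add"
  assumes sm: "small_for_group TYPE('a) m" "a \<noteq> 0" and ground: "ground M = multiples m a"
    and B: "B \<subseteq> multiples m a" "card B = n"
  shows "basis_matched_to M B (top_multiples n m a)"
proof -
  define I where "I = {i \<in> {1..m}. nmult i a \<in> B}"
  define ks where "ks = sorted_list_of_set I"
  have inj: "inj_on (\<lambda>i. nmult i a) {..m}"
    by (rule inj_on_subset[OF nmult_inj[OF sm]]) auto
  have I: "finite I" "I \<subseteq> {1..m}" "I \<subseteq> {..m}" by (auto simp: I_def)
  have BI: "B = (\<lambda>i. nmult i a) ` I" using B(1) by (auto simp: I_def multiples_def)
  hence len: "length ks = n" using B(2) I inj_on_subset[OF inj]
    by (simp add: ks_def card_image)
  have nm: "n \<le> m" using I card_mono[of "{1..m}" I] len by (simp add: ks_def)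
  have set_ks: "set ks = I" using I by (simp add: ks_def)
  \<comment> \<open>The prepended 0 records that the indices are positive; it turns the bound
    \<open>i \<le> ks ! i\<close> into \<open>Suc i \<le> ks ! i\<close>.\<close>
  have sorted: "sorted_wrt (<) (0 # ks)"
    using I by (auto simp: ks_def strict_sorted_list_of_set)
  have idx: "Suc i \<le> ks ! i" if "i < n" for i
    using sorted_wrt_less_idx[OF sorted, of "Suc i"] that len by simp
  define as where "as = map (\<lambda>i. nmult i a) ks"
  define bs where "bs = map (\<lambda>i. nmult (m - i) a) [0..<n]"
  have "distinct as"
    using I inj_on_subset[OF inj] by (auto simp: as_def distinct_map set_ks ks_def)
  moreover have "set as = B" by (simp add: as_def set_ks BI)
  moreover have "inj_on (\<lambda>i. nmult (m - i) a) {0..<n}"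
    using inj_onD[OF inj] nm by (intro inj_onI) fastforce
  hence "distinct bs" by (auto simp: bs_def distinct_map)
  moreover have "{m - n<..m} = (-) m ` {0..<n}"
  proof
    show "{m - n<..m} \<subseteq> (-) m ` {0..<n}"
    proof
      fix k assume "k \<in> {m - n<..m}"
      hence "k = m - (m - k)" "m - k \<in> {0..<n}" using nm by auto
      thus "k \<in> (-) m ` {0..<n}" by (rule image_eqI)
    qed
  qed (use nm in auto)
  hence "set bs = top_multiples n m a"
    by (simp add: bs_def top_multiples_def image_image)
  moreover have "as ! i + bs ! i \<notin> multiples m a" if "i < n" for i
  proof -
    have "ks ! i \<le> m" using I(2) len that set_ks nth_mem[of i "ks"] by auto
    hence "nmult (ks ! i + (m - i)) a \<notin> multiples m a"
      using idx[OF that] that nm by (intro nmult_notin_multiples[OF sm]) auto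
    thus ?thesis using that len by (simp add: as_def bs_def nmult_add)
  qed
  ultimately show ?thesis
    unfolding basis_matched_to_def ordered_bases_matched_def ground
    by (intro exI[of _ as] exI[of _ bs]) (auto simp: as_def bs_def len)
qed

text \<open>The partner of an element of index \<open>j\<close> has index \<open>i \<le> n\<close>,
  and \<open>i + j > m\<close> forces \<open>j > m - n\<close>. Equal sizes turn the resulting
  inclusion into equality.\<close>

lemma lowest_matched_only_to_top:
  fixes a :: "'a::ab_group_add"
  assumes sm: "small_for_group TYPE('a) m" "a \<noteq> 0" and ground: "ground M = multiples m a"
    and n: "n \<le> m" and B: "B \<subseteq> multiples m a" "card B = n"
    and matched: "basis_matched_to M (multiples n a) B"
  shows "B = top_multiples n m a"
proof (rule card_subset_eq)
  obtain as bs where *: "set as = multiples n a" "set bs = B" "length as = length bs"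
      "\<And>i. i < length as \<Longrightarrow> as ! i + bs ! i \<notin> multiples m a"
    using matched unfolding basis_matched_to_def ordered_bases_matched_def ground by blast
  show "B \<subseteq> top_multiples n m a"
  proof
    fix b assume b: "b \<in> B"
    then obtain l where l: "l < length bs" "b = bs ! l" using * by (metis in_set_conv_nth)
    have "as ! l \<in> multiples n a" using * l by (metis nth_mem)
    then obtain i where i: "as ! l = nmult i a" "1 \<le> i" "i \<le> n"
      by (auto simp: multiples_def)
    from b B obtain j where j: "b = nmult j a" "1 \<le> j" "j \<le> m" by (auto simp: multiples_def)
    have "nmult (i + j) a \<notin> multiples m a" using *(4)[of l] *(3) i(1) j(1) l by (simp add: nmult_add)
    hence "\<not> i + j \<le> m" using i(2) unfolding multiples_def by force
    thus "b \<in> top_multiples n m a" using i j n by (auto simp: top_multiples_def)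
  qed
  show "finite (top_multiples n m a)" by (simp add: top_multiples_def)
  show "card B = card (top_multiples n m a)" using B card_top_multiples[OF sm n] by simp
qed

theorem theorem4p8:
  fixes a :: "'a::ab_group_add" and n s m :: nat
    and r :: "'a rel" and S S' :: "'a set" and M :: "'a matroid"
  assumes "0 < n" and "n \<le> s" and "s < m"
    and "small_for_group TYPE('a) m"
    and "a \<noteq> 0"
    and "compatible_order_on (multiples (2 * m) a \<union> {0}) r"
    and "S \<subseteq> multiples m a" and "card S = n"
    and "S' \<subseteq> multiples m a" and "card S' = n"
    and "M = schubert_matroid r m a S \<or> M = panhandle_matroid n s m a"
  shows "matched_to M (schubert_matroid r m a S') \<longleftrightarrow>
         matroid_isomorphic (schubert_matroid r m a S') (uniform_matroid n m)"
proof -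
  note sm = assms(4,5) and r = assms(6)
  let ?N = "schubert_matroid r m a S'"
  have nm: "n \<le> m" using assms by simp
  have ground: "ground M = multiples m a"
    and basesM: "\<And>B. B \<in> bases M \<Longrightarrow> B \<subseteq> multiples m a \<and> card B = n"
    using assms(8,11) by (auto simp: schubert_matroid_def panhandle_matroid_def)
  have groundN: "ground ?N = multiples m a"
    and basesN: "\<And>B. B \<in> bases ?N \<Longrightarrow> B \<subseteq> multiples m a \<and> card B = n"
    using assms(10) by (auto simp: schubert_matroid_def)
  have low: "multiples n a \<in> bases M"
    using assms lowest_basis_schubert[OF sm r assms(7)] lowest_basis_panhandle[OF sm, of n s] by auto
  have iso: "matroid_isomorphic ?N (uniform_matroid n m) \<longleftrightarrow>
      (\<forall>B. B \<subseteq> multiples m a \<longrightarrow> card B = n \<longrightarrow> B \<in> bases ?N)"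
    using isomorphic_uniform_iff[of ?N m n] basesN card_multiples[OF sm] groundN by simp
  show ?thesis
  proof
    \<comment> \<open>The lowest basis alone tests the hypothesis: whichever basis it is matched to
      must be the highest n-set.\<close>
    assume "matched_to M ?N"
    then obtain B where B: "B \<in> bases ?N" "basis_matched_to M (multiples n a) B"
      using low unfolding matched_to_def by blast
    hence "top_multiples n m a \<in> bases ?N"
      using lowest_matched_only_to_top[OF sm ground nm] basesN by metis
    thus "matroid_isomorphic ?N (uniform_matroid n m)"
      unfolding iso using schubert_uniform_if_top_basis[OF sm r assms(9), of n] assms(10) by simp
  next
    assume "matroid_isomorphic ?N (uniform_matroid n m)"
    hence "top_multiples n m a \<in> bases ?N"
      unfolding iso using top_multiples_subset card_top_multiples[OF sm nm] by blast
    \<comment> \<open>One and the same basis of the Schubert matroid serves as partner for every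
      basis of \<open>M\<close>.\<close>
    moreover have "basis_matched_to M B (top_multiples n m a)" if "B \<in> bases M" for B
      using basesM[OF that] by (intro basis_matched_to_top[OF sm ground]) auto
    ultimately show "matched_to M ?N" unfolding matched_to_def by (intro ballI bexI)
  qed
qed

end
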